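(* Given a connected $(2P_2+P_1)$-free graph $G$ with $n$ vertices and $m$ edges, one can decide whether $\operatorname{diam}(G)=5$ in $O(n+m)$ time. (Here $5=d_{\max}$, the maximum diameter of a connected $(2P_2+P_1)$-free graph.)
   Context: Graphs are finite, simple, undirected and unweighted. A graph is $H$-free if it does not contain $H$ as an induced subgraph; $2P_2+P_1$ is the disjoint union of two edges and an isolated vertex. $\operatorname{diam}(G)=\max_{u,v}d(u,v)$; $d_{\max}$ of a class is the supremum of the diameters of its graphs. *)

theory Defs
  imports Main "HOL-Library.Extended_Nat"
begin

section \<open>Finite simple graphs\<close>

type_synonym 'a graph = "'a set \<times> 'a set set"

abbreviation verts :: "'a graph \<Rightarrow> 'a set" where "verts G \<equiv> fst G"
abbreviation edges :: "'a graph \<Rightarrow> 'a set set" where "edges G \<equiv> snd G"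

definition simple_graph :: "'a graph \<Rightarrow> bool" where
  "simple_graph G \<longleftrightarrow> finite (verts G) \<and> (\<forall>e\<in>edges G. e \<subseteq> verts G \<and> card e = 2)"

definition is_path :: "'a graph \<Rightarrow> 'a \<Rightarrow> 'a list \<Rightarrow> 'a \<Rightarrow> bool" where
  "is_path G u xs v \<longleftrightarrow> xs \<noteq> [] \<and> hd xs = u \<and> last xs = v \<and> distinct xs \<and> set xs \<subseteq> verts G
     \<and> successively (\<lambda>x y. {x, y} \<in> edges G) xs"

definition connected_graph :: "'a graph \<Rightarrow> bool" where
  "connected_graph G \<longleftrightarrow> verts G \<noteq> {} \<and> (\<forall>u\<in>verts G. \<forall>v\<in>verts G. \<exists>xs. is_path G u xs v)"

text \<open>The length of a path is its number of edges. The value is only meaningful if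
  \<open>u\<close> and \<open>v\<close> lie in the same component.\<close>

definition gdist :: "'a graph \<Rightarrow> 'a \<Rightarrow> 'a \<Rightarrow> nat" where
  "gdist G u v = (LEAST k. \<exists>xs. is_path G u xs v \<and> length xs = Suc k)"

definition diam :: "'a graph \<Rightarrow> nat" where
  "diam G = Max {gdist G u v | u v. u \<in> verts G \<and> v \<in> verts G}"

definition induced_subgraph :: "'a graph \<Rightarrow> 'a set \<Rightarrow> 'a graph" where
  "induced_subgraph G S = (S, {e \<in> edges G. e \<subseteq> S})"

definition graph_iso :: "'a graph \<Rightarrow> 'b graph \<Rightarrow> bool" where
  "graph_iso G H \<longleftrightarrow> (\<exists>f. bij_betw f (verts G) (verts H) \<and>
     (\<forall>u\<in>verts G. \<forall>v\<in>verts G. {u, v} \<in> edges G \<longleftrightarrow> {f u, f v} \<in> edges H))"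

definition free_of :: "'b graph \<Rightarrow> 'a graph \<Rightarrow> bool" where
  "free_of H G \<longleftrightarrow> \<not> (\<exists>S \<subseteq> verts G. graph_iso (induced_subgraph G S) H)"

definition graph_2P2_P1 :: "nat graph" where
  "graph_2P2_P1 = ({0, 1, 2, 3, 4}, {{0, 1}, {2, 3}})"

text \<open>Every finite graph is isomorphic to one whose vertices are natural numbers, so
  it suffices to take the supremum over those.\<close>

definition d_max :: "'b graph \<Rightarrow> enat" where
  "d_max H = (SUP G \<in> {G :: nat graph. simple_graph G \<and> connected_graph G \<and> free_of H G}.
     enat (diam G))"


section \<open>A random access machine\<close>

text \<open>Programs are structured programs over natural-number registers and finitely many
  (per program) arrays, both named by natural numbers. Every arithmetic operation,
  comparison, memory access and branch costs one step. The only arithmetic is addition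
  and truncated subtraction.\<close>

datatype aexp =
    Const nat
  | Reg nat
  | Read nat aexp        \<comment> \<open>\<open>Read A i\<close>: the entry of array \<open>A\<close> at index \<open>i\<close>\<close>
  | Plus aexp aexp
  | Minus aexp aexp

datatype bexp = Less aexp aexp | Equal aexp aexp | Neg bexp | Conj bexp bexp

datatype prog =
    SKIP
  | Assign nat aexp
  | Write nat aexp aexp  \<comment> \<open>\<open>Write A i a\<close>: store \<open>a\<close> in array \<open>A\<close> at index \<open>i\<close>\<close>
  | Seq prog prog
  | IF bexp prog prog
  | WHILE bexp prog

type_synonym state = "(nat \<Rightarrow> nat) \<times> (nat \<Rightarrow> nat \<Rightarrow> nat)"

fun aval :: "state \<Rightarrow> aexp \<Rightarrow> nat" where
  "aval s (Const k) = k"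
| "aval s (Reg x) = fst s x"
| "aval s (Read A i) = snd s A (aval s i)"
| "aval s (Plus a b) = aval s a + aval s b"
| "aval s (Minus a b) = aval s a - aval s b"

fun bval :: "state \<Rightarrow> bexp \<Rightarrow> bool" where
  "bval s (Less a b) \<longleftrightarrow> aval s a < aval s b"
| "bval s (Equal a b) \<longleftrightarrow> aval s a = aval s b"
| "bval s (Neg b) \<longleftrightarrow> \<not> bval s b"
| "bval s (Conj b c) \<longleftrightarrow> bval s b \<and> bval s c"

fun acost :: "aexp \<Rightarrow> nat" where
  "acost (Const k) = 1"
| "acost (Reg x) = 1"
| "acost (Read A i) = acost i + 1"
| "acost (Plus a b) = acost a + acost b + 1"
| "acost (Minus a b) = acost a + acost b + 1"

fun bcost :: "bexp \<Rightarrow> nat" where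
  "bcost (Less a b) = acost a + acost b + 1"
| "bcost (Equal a b) = acost a + acost b + 1"
| "bcost (Neg b) = bcost b + 1"
| "bcost (Conj b c) = bcost b + bcost c + 1"

text \<open>Words have bounded size: every value occurring in the evaluation of an expression,
  array indices included, must be at most \<open>W\<close>. This rules out speed-ups by packing a lot
  of information into one large number.\<close>

fun afits :: "nat \<Rightarrow> state \<Rightarrow> aexp \<Rightarrow> bool" where
  "afits W s (Const k) \<longleftrightarrow> k \<le> W"
| "afits W s (Reg x) \<longleftrightarrow> fst s x \<le> W"
| "afits W s (Read A i) \<longleftrightarrow> afits W s i \<and> snd s A (aval s i) \<le> W"
| "afits W s (Plus a b) \<longleftrightarrow> afits W s a \<and> afits W s b \<and> aval s a + aval s b \<le> W"
| "afits W s (Minus a b) \<longleftrightarrow> afits W s a \<and> afits W s b"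

fun bfits :: "nat \<Rightarrow> state \<Rightarrow> bexp \<Rightarrow> bool" where
  "bfits W s (Less a b) \<longleftrightarrow> afits W s a \<and> afits W s b"
| "bfits W s (Equal a b) \<longleftrightarrow> afits W s a \<and> afits W s b"
| "bfits W s (Neg b) \<longleftrightarrow> bfits W s b"
| "bfits W s (Conj b c) \<longleftrightarrow> bfits W s b \<and> bfits W s c"

text \<open>\<open>exec W p s t s'\<close>: started in \<open>s\<close>, program \<open>p\<close> halts in \<open>s'\<close> after exactly \<open>t\<close>
  steps, and no value ever exceeds \<open>W\<close>. If a value exceeded \<open>W\<close> or \<open>p\<close> did not halt,
  no \<open>t\<close> and \<open>s'\<close> would be related to \<open>p\<close> and \<open>s\<close>.\<close>

inductive exec :: "nat \<Rightarrow> prog \<Rightarrow> state \<Rightarrow> nat \<Rightarrow> state \<Rightarrow> bool" for W :: nat where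
  Skip: "exec W SKIP s 1 s"
| Assign: "afits W s a \<Longrightarrow>
    exec W (Assign x a) s (acost a + 1) ((fst s)(x := aval s a), snd s)"
| Write: "afits W s i \<Longrightarrow> afits W s a \<Longrightarrow>
    exec W (Write A i a) s (acost i + acost a + 1)
      (fst s, (snd s)(A := (snd s A)(aval s i := aval s a)))"
| Seq: "exec W p s t s' \<Longrightarrow> exec W q s' t' s'' \<Longrightarrow> exec W (Seq p q) s (t + t') s''"
| IfTrue: "bfits W s b \<Longrightarrow> bval s b \<Longrightarrow> exec W p s t s' \<Longrightarrow>
    exec W (IF b p q) s (bcost b + 1 + t) s'"
| IfFalse: "bfits W s b \<Longrightarrow> \<not> bval s b \<Longrightarrow> exec W q s t s' \<Longrightarrow>
    exec W (IF b p q) s (bcost b + 1 + t) s'"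
| WhileFalse: "bfits W s b \<Longrightarrow> \<not> bval s b \<Longrightarrow> exec W (WHILE b p) s (bcost b + 1) s"
| WhileTrue: "bfits W s b \<Longrightarrow> bval s b \<Longrightarrow> exec W p s t s' \<Longrightarrow> exec W (WHILE b p) s' t' s'' \<Longrightarrow>
    exec W (WHILE b p) s (bcost b + 1 + t + t') s''"

inductive_cases SkipE: "exec W SKIP s t s'"
inductive_cases AssignE: "exec W (Assign x a) s t s'"
inductive_cases WriteE: "exec W (Write A i a) s t s'"
inductive_cases SeqE: "exec W (Seq p q) s t s'"
inductive_cases IfE: "exec W (IF b p q) s t s'"
inductive_cases WhileE: "exec W (WHILE b p) s t s'"

lemma exec_deterministic:
  "exec W p s t s' \<Longrightarrow> exec W p s u s'' \<Longrightarrow> u = t \<and> s'' = s'"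
proof (induction arbitrary: u s'' rule: exec.induct)
  case Skip
  then show ?case by (auto elim: SkipE)
next
  case Assign
  then show ?case by (auto elim: AssignE)
next
  case Write
  then show ?case by (auto elim: WriteE)
next
  case Seq
  show ?case by (rule SeqE[OF Seq.prems]) (metis Seq.IH)
next
  case IfTrue
  show ?case by (rule IfE[OF IfTrue.prems]) (auto simp: IfTrue.hyps dest!: IfTrue.IH)
next
  case IfFalse
  show ?case by (rule IfE[OF IfFalse.prems]) (auto simp: IfFalse.hyps dest!: IfFalse.IH)
next
  case WhileFalse
  show ?case by (rule WhileE[OF WhileFalse.prems]) (auto simp: WhileFalse.hyps)
next
  case WhileTrue
  show ?case by (rule WhileE[OF WhileTrue.prems]) (simp_all add: WhileTrue.hyps, metis WhileTrue.IH)
qed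


section \<open>Graphs as inputs\<close>

text \<open>An input graph has vertices \<open>0, \<dots>, n - 1\<close> and is given by adjacency lists, the
  neighbours of each vertex being listed in arbitrary order.\<close>

definition adj_lists :: "nat graph \<Rightarrow> nat list list \<Rightarrow> bool" where
  "adj_lists G adj \<longleftrightarrow> verts G = {..<length adj} \<and>
     (\<forall>v<length adj. distinct (adj ! v) \<and> set (adj ! v) = {u. {v, u} \<in> edges G})"

text \<open>The adjacency lists are stored one after the other in array 1; the list of vertex
  \<open>v\<close> occupies the indices from (array 0)[\<open>v\<close>] up to but excluding (array 0)[\<open>v + 1\<close>].
  Registers 0 and 1 hold the numbers of vertices and of edges. All other memory is 0.\<close>

definition input_state :: "nat graph \<Rightarrow> nat list list \<Rightarrow> state" where
  "input_state G adj =
     ((\<lambda>_. 0)(0 := card (verts G), 1 := card (edges G)),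
      (\<lambda>_ _. 0)(0 := (\<lambda>v. if v \<le> length adj then length (concat (take v adj)) else 0),
                1 := (\<lambda>i. if i < length (concat adj) then concat adj ! i else 0)))"

definition result :: "state \<Rightarrow> nat" where
  "result s = fst s 0"

end

theory Submission
  imports Defs
begin

text \<open>A shortest path of length 6 contains an induced \<open>2P\<^sub>2 + P\<^sub>1\<close>, so the diameter is at most 5,
  and \<open>P\<^sub>6\<close> attains this.

  For the algorithm, call \<open>z\<close> farthest from \<open>w\<close> if it has minimum degree within the last layer of the
  breadth-first search from \<open>w\<close>. Start at any \<open>w\<close>, let \<open>z\<close> be farthest from \<open>w\<close> and \<open>y\<close> farthest from
  \<open>z\<close>; the diameter is 5 iff the eccentricity of \<open>y\<close> is 5. Let \<open>u, v\<close> be at distance 5. Every vertex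
  is within distance 2 of \<open>u\<close> or of \<open>v\<close>; say \<open>w\<close> is near \<open>u\<close>. If the eccentricity of \<open>w\<close> is at most 4,
  then either \<open>v\<close> lies in layer 4, whose vertices all have the same neighbourhood as \<open>v\<close>, so that \<open>z\<close> has
  eccentricity 5; or \<open>w\<close> is at distance 2 from \<open>u\<close> and 3 from \<open>v\<close>, and then \<open>z\<close> has distance at
  least 4 from \<open>u\<close>, so that the first case applies to \<open>z\<close> with \<open>u\<close> and \<open>v\<close> exchanged.\<close>

section \<open>Distances\<close>

text \<open>Walks of length \<open>k\<close> are the pairs in the \<open>k\<close>-th relational
  power. They concatenate and reverse without regard to repeated vertices, so metric facts are
  proved for walks instead of for \<open>is_path\<close>.\<close>

definition adjacency :: "'a graph \<Rightarrow> ('a \<times> 'a) set" where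
  "adjacency G = {(x, y). {x, y} \<in> edges G}"

definition neighbours :: "'a graph \<Rightarrow> 'a \<Rightarrow> 'a set" where
  "neighbours G v = {u. {v, u} \<in> edges G}"

lemma simple_graph_edgeD:
  assumes "simple_graph G" "{x, y} \<in> edges G"
  shows "x \<in> verts G" "y \<in> verts G" "x \<noteq> y"
proof -
  have *: "{x, y} \<subseteq> verts G \<and> card {x, y} = 2"
    using assms unfolding simple_graph_def by blast
  then show "x \<in> verts G" "y \<in> verts G" by auto
  show "x \<noteq> y" using * by (cases "x = y") auto
qed

lemma path_imp_relpow:
  assumes "successively (\<lambda>x y. {x, y} \<in> edges G) xs" "xs \<noteq> []"
  shows "(hd xs, last xs) \<in> adjacency G ^^ (length xs - 1)"
  using assms
proof (induction xs rule: rev_induct)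
  case (snoc x xs)
  show ?case
  proof (cases "xs = []")
    case False
    then have "(hd xs, last xs) \<in> adjacency G ^^ (length xs - 1)" "(last xs, x) \<in> adjacency G"
      using snoc by (auto simp: successively_append_iff adjacency_def)
    then have "(hd xs, x) \<in> adjacency G ^^ Suc (length xs - 1)" by auto
    then show ?thesis using False by simp
  qed simp
qed simp

text \<open>A walk may repeat vertices, a path may not: when the next vertex already lies on the
  path, the path is cut there. Hence only an upper bound on its length.\<close>

lemma relpow_imp_path:
  assumes "simple_graph G" "u \<in> verts G" "(u, v) \<in> adjacency G ^^ k"
  shows "\<exists>xs. is_path G u xs v \<and> length xs \<le> Suc k"
  using assms(3)
proof (induction k arbitrary: v)
  case 0
  then have "is_path G u [u] v" using assms by (simp add: is_path_def)
  then show ?case by force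
next
  case (Suc k)
  then obtain y where y: "(u, y) \<in> adjacency G ^^ k" "{y, v} \<in> edges G"
    by (auto simp: adjacency_def)
  then obtain xs where xs: "is_path G u xs y" "length xs \<le> Suc k" using Suc.IH by blast
  show ?case
  proof (cases "v \<in> set xs")
    case True
    then obtain as bs where ab: "xs = as @ v # bs" by (auto simp: in_set_conv_decomp)
    then have xs': "xs = (as @ [v]) @ bs" by simp
    then have "is_path G u (as @ [v]) v" using xs(1) unfolding is_path_def xs'
        successively_append_iff[of _ "as @ [v]"]
      by (cases as) auto
    moreover have "length (as @ [v]) \<le> Suc (Suc k)" using xs(2) ab by simp
    ultimately show ?thesis by blast
  next
    case False
    have "v \<in> verts G" using simple_graph_edgeD[OF assms(1) y(2)] by simp
    then have "is_path G u (xs @ [v]) v" using False xs(1) y(2) unfolding is_path_def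
      by (auto simp: successively_append_iff)
    then show ?thesis using xs(2) by (metis Suc_le_mono length_append_singleton)
  qed
qed

locale finite_connected_graph =
  fixes G :: "'a graph"
  assumes simple: "simple_graph G" and connected: "connected_graph G"
begin

abbreviation V where "V \<equiv> verts G"
abbreviation d where "d \<equiv> gdist G"
abbreviation adjacent (infix "\<sim>" 50) where "x \<sim> y \<equiv> {x, y} \<in> edges G"

lemma finite_V: "finite V"
  using simple by (simp add: simple_graph_def)

lemma V_nonempty: "V \<noteq> {}"
  using connected by (simp add: connected_graph_def)

lemma adjacentD:
  assumes "x \<sim> y"
  shows "x \<in> V" "y \<in> V" "x \<noteq> y" "y \<sim> x"
  using simple_graph_edgeD[OF simple assms] assms by (auto simp: insert_commute)

lemma adjacent_sym: "x \<sim> y \<longleftrightarrow> y \<sim> x"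
  by (simp add: insert_commute)

lemma gdist_relpow:
  assumes "u \<in> V" "v \<in> V"
  shows "(u, v) \<in> adjacency G ^^ d u v"
proof -
  obtain xs where "is_path G u xs v" using connected assms unfolding connected_graph_def by blast
  then have "\<exists>k xs. is_path G u xs v \<and> length xs = Suc k"
    by (metis is_path_def length_0_conv not0_implies_Suc)
  then have "\<exists>xs. is_path G u xs v \<and> length xs = Suc (d u v)"
    unfolding gdist_def by (rule LeastI_ex)
  then obtain xs where "is_path G u xs v" "length xs = Suc (d u v)" by blast
  then show ?thesis using path_imp_relpow[of G xs] by (auto simp: is_path_def)
qed

lemma gdist_le_relpow:
  assumes "u \<in> V" "(u, v) \<in> adjacency G ^^ k"
  shows "d u v \<le> k"
proof -
  obtain xs where xs: "is_path G u xs v" "length xs \<le> Suc k"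
    using relpow_imp_path[OF simple assms] by blast
  then have "length xs = Suc (length xs - 1)" by (auto simp: is_path_def)
  then have "d u v \<le> length xs - 1" unfolding gdist_def using xs(1) by (blast intro: Least_le)
  then show ?thesis using xs(2) by simp
qed

lemma gdist_same: "u \<in> V \<Longrightarrow> d u u = 0"
  using gdist_le_relpow[of u u 0] by simp

lemma gdist_eq_0: "u \<in> V \<Longrightarrow> v \<in> V \<Longrightarrow> d u v = 0 \<longleftrightarrow> u = v"
  using gdist_relpow[of u v] gdist_same by auto

lemma gdist_commute:
  assumes "u \<in> V" "v \<in> V"
  shows "d u v = d v u"
proof -
  have le: "d y x \<le> d x y" if "x \<in> V" "y \<in> V" for x y
  proof (rule gdist_le_relpow)
    have "(b, a) \<in> adjacency G ^^ k" if "(a, b) \<in> adjacency G ^^ k" for a b k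
      using that
    proof (induction k arbitrary: b)
      case (Suc k)
      then obtain c where c: "(a, c) \<in> adjacency G ^^ k" "c \<sim> b" by (auto simp: adjacency_def)
      then have "(b, c) \<in> adjacency G" by (simp add: adjacency_def insert_commute)
      then show ?case using Suc.IH[OF c(1)] by (rule relpow_Suc_I2)
    qed simp
    then show "(y, x) \<in> adjacency G ^^ d x y" using gdist_relpow[OF that] by blast
  qed (use that in simp)
  show ?thesis using le assms by (simp add: le_antisym)
qed

lemma gdist_triangle:
  assumes "u \<in> V" "v \<in> V" "w \<in> V"
  shows "d u w \<le> d u v + d v w"
  using gdist_le_relpow[of u w "d u v + d v w"] gdist_relpow[of u v] gdist_relpow[of v w] assms
  by (auto simp: relpow_add)

lemma gdist_adjacent: "x \<sim> y \<Longrightarrow> d x y = 1"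
  using gdist_le_relpow[of x y 1] gdist_eq_0[of x y] adjacentD[of x y]
  by (auto simp: adjacency_def)

lemma gdist_step: "u \<in> V \<Longrightarrow> x \<sim> y \<Longrightarrow> d u y \<le> Suc (d u x)"
  using gdist_triangle[of u x y] gdist_adjacent adjacentD[of x y] by simp

lemma gdist_step': "u \<in> V \<Longrightarrow> x \<sim> y \<Longrightarrow> d u x \<le> Suc (d u y)"
  using gdist_step adjacent_sym by blast

lemma gdist_pred:
  assumes "u \<in> V" "x \<in> V" "d u x = Suc k"
  obtains y where "y \<sim> x" "d u y = k"
proof -
  obtain y where y: "(u, y) \<in> adjacency G ^^ k" "y \<sim> x"
    using gdist_relpow[OF assms(1,2)] assms(3) by (auto simp: adjacency_def)
  then have "d u y = k" using gdist_le_relpow[OF assms(1) y(1)] gdist_step[OF assms(1) y(2)] assms(3)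
    by simp
  then show ?thesis using y that by blast
qed

lemma gdist_1: "x \<in> V \<Longrightarrow> y \<in> V \<Longrightarrow> d x y = Suc 0 \<Longrightarrow> x \<sim> y"
  using gdist_eq_0 adjacentD by (metis gdist_pred)

lemma finite_gdists: "finite {d u v | u v. u \<in> V \<and> v \<in> V}"
proof -
  have "{d u v | u v. u \<in> V \<and> v \<in> V} = (\<lambda>(u, v). d u v) ` (V \<times> V)" by auto
  then show ?thesis using finite_V by simp
qed

lemma gdist_le_diam: "u \<in> V \<Longrightarrow> v \<in> V \<Longrightarrow> d u v \<le> diam G"
  unfolding diam_def by (rule Max_ge[OF finite_gdists]) blast

lemma diam_witness:
  obtains u v where "u \<in> V" "v \<in> V" "d u v = diam G"
proof -
  have "Max {d u v | u v. u \<in> V \<and> v \<in> V} \<in> {d u v | u v. u \<in> V \<and> v \<in> V}"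
    by (rule Max_in[OF finite_gdists]) (use V_nonempty in auto)
  then show ?thesis using that unfolding diam_def by force
qed

lemma finite_neighbours: "finite (neighbours G v)"
  by (rule finite_subset[OF _ finite_V]) (auto simp: neighbours_def adjacentD)

end

section \<open>The forbidden induced subgraph\<close>

text \<open>Distinctness comes from the adjacencies: \<open>a = c\<close>, for example, would turn
  the edge \<open>{c, d}\<close> into the non-edge \<open>{a, d}\<close>, and \<open>a = b\<close>
  would be a loop.\<close>

lemma graph_iso_2P2_P1_I:
  assumes "{a, b} \<in> edges G" "{c, d} \<in> edges G" "e \<in> verts G" "simple_graph G"
    and "{a, c} \<notin> edges G" "{a, d} \<notin> edges G" "{b, c} \<notin> edges G" "{b, d} \<notin> edges G"
    and "{e, a} \<notin> edges G" "{e, b} \<notin> edges G" "{e, c} \<notin> edges G" "{e, d} \<notin> edges G"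
  shows "\<not> free_of graph_2P2_P1 G"
proof -
  let ?S = "{a, b, c, d, e}"
  \<comment> \<open>The default value 4 is the isolated vertex, the image of
    \<open>e\<close>.\<close>
  let ?f = "(\<lambda>_. 4)(a := 0, b := 1, c := 2, d := 3::nat)"
  have loop: "{x, x} \<notin> edges G" for x using simple_graph_edgeD(3)[OF assms(4)] by blast
  have ne: "a \<noteq> b" "c \<noteq> d" "a \<noteq> c" "a \<noteq> d" "b \<noteq> c" "b \<noteq> d" "e \<noteq> a" "e \<noteq> b" "e \<noteq> c" "e \<noteq> d"
    using assms loop by (auto simp: insert_commute)
  have comm: "{x, y} \<in> edges G \<longleftrightarrow> {y, x} \<in> edges G" for x y by (simp add: insert_commute)
  have rev: "{b, a} \<in> edges G" "{d, c} \<in> edges G"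
    "{c, a} \<notin> edges G" "{d, a} \<notin> edges G" "{c, b} \<notin> edges G" "{d, b} \<notin> edges G"
    "{a, e} \<notin> edges G" "{b, e} \<notin> edges G" "{c, e} \<notin> edges G" "{d, e} \<notin> edges G"
    using assms(1,2,5-) by (simp_all only: comm[of b a] comm[of d c] comm[of c a] comm[of d a]
      comm[of c b] comm[of d b] comm[of a e] comm[of b e] comm[of c e] comm[of d e] simp_thms)
  have sub: "?S \<subseteq> verts G" using simple_graph_edgeD[OF assms(4)] assms(1-3) by auto
  have bij: "bij_betw ?f ?S {0, 1, 2, 3, 4}" using ne by (auto simp: bij_betw_def inj_on_def)
  have edge: "\<forall>u\<in>?S. \<forall>v\<in>?S. ({u, v} \<in> edges G) = ({?f u, ?f v} \<in> {{0, 1}, {2, 3}})"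
    using assms(1,2,5-) rev ne ne[symmetric] by (simp add: doubleton_eq_iff loop[simplified])
  have "graph_iso (induced_subgraph G ?S) graph_2P2_P1"
    unfolding graph_iso_def induced_subgraph_def graph_2P2_P1_def fst_conv snd_conv
  proof (intro exI conjI ballI)
    fix u v assume uv: "u \<in> ?S" "v \<in> ?S"
    then have "{u, v} \<subseteq> ?S" by (simp only: insert_subset empty_subsetI simp_thms)
    then show "({u, v} \<in> {e \<in> edges G. e \<subseteq> ?S}) = ({?f u, ?f v} \<in> {{0, 1}, {2, 3}})"
      using edge[rule_format, OF uv] by (simp only: mem_Collect_eq simp_thms)
  qed (rule bij)
  then show ?thesis using sub unfolding free_of_def by blast
qed

text \<open>The converse, for verifying that the path on six vertices is free: the five vertices are
  the preimages of 0, ..., 4 under the isomorphism.\<close>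

lemma graph_iso_2P2_P1_D:
  assumes "\<not> free_of graph_2P2_P1 G"
  obtains a b c d e where "{a, b} \<in> edges G" "{c, d} \<in> edges G" "e \<in> verts G"
    "{a, c} \<notin> edges G" "{a, d} \<notin> edges G" "{b, c} \<notin> edges G" "{b, d} \<notin> edges G"
    "{e, a} \<notin> edges G" "{e, b} \<notin> edges G" "{e, c} \<notin> edges G" "{e, d} \<notin> edges G"
    "a \<noteq> c" "a \<noteq> d" "b \<noteq> c" "b \<noteq> d"
proof -
  obtain S f where S: "S \<subseteq> verts G" "bij_betw f S {0::nat, 1, 2, 3, 4}"
    and iso: "\<forall>u\<in>S. \<forall>v\<in>S. ({u, v} \<in> {e \<in> edges G. e \<subseteq> S}) = ({f u, f v} \<in> {{0, 1}, {2, 3}})"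
    using assms unfolding free_of_def graph_iso_def induced_subgraph_def graph_2P2_P1_def fst_conv snd_conv
    by blast
  define g where "g = inv_into S f"
  have g: "g i \<in> S" "f (g i) = i" if "i \<in> {0, 1, 2, 3, 4}" for i
  proof -
    have "i \<in> f ` S" using S(2) that by (simp add: bij_betw_def)
    then show "g i \<in> S" "f (g i) = i" unfolding g_def by (rule inv_into_into, rule f_inv_into_f)
  qed
  have iso': "{g i, g j} \<in> edges G \<longleftrightarrow> {i, j} \<in> {{0, 1}, {2, 3}}"
    if "i \<in> {0, 1, 2, 3, 4}" "j \<in> {0, 1, 2, 3, 4}" for i j
  proof -
    have "({g i, g j} \<in> {e \<in> edges G. e \<subseteq> S}) = ({i, j} \<in> {{0, 1}, {2, 3}})"
      using iso[rule_format, OF g(1)[OF that(1)] g(1)[OF that(2)]] unfolding g(2)[OF that(1)] g(2)[OF that(2)] .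
    moreover have "{g i, g j} \<subseteq> S" using g(1)[OF that(1)] g(1)[OF that(2)] by simp
    ultimately show ?thesis by (simp only: mem_Collect_eq simp_thms)
  qed
  have ne: "g i \<noteq> g j" if "i \<in> {0, 1, 2, 3, 4}" "j \<in> {0, 1, 2, 3, 4}" "i \<noteq> j" for i j
    using g(2)[OF that(1)] g(2)[OF that(2)] that(3) by auto
  show ?thesis
    by (rule that[of "g 0" "g 1" "g 2" "g 3" "g 4"])
       (use g(1)[of 4] S(1) ne in \<open>auto simp: iso' doubleton_eq_iff\<close>)
qed

section \<open>Structure around a pair of vertices at distance 5\<close>

locale connected_2P2_P1_free_graph = finite_connected_graph +
  assumes free: "free_of graph_2P2_P1 G"
begin

lemma no_2P2_P1:
  assumes "a \<sim> b" "c \<sim> f" "e \<in> V"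
    "\<not> a \<sim> c" "\<not> a \<sim> f" "\<not> b \<sim> c" "\<not> b \<sim> f"
    "\<not> e \<sim> a" "\<not> e \<sim> b" "\<not> e \<sim> c" "\<not> e \<sim> f"
  shows False
  using graph_iso_2P2_P1_I[OF assms(1-3) simple assms(4-)] free by blast

text \<open>Almost all non-adjacencies come from distances to a common vertex.\<close>

lemma nonadjacent:
  assumes "r \<in> V" "Suc (d r x) < d r y \<or> Suc (d r y) < d r x"
  shows "\<not> x \<sim> y"
  using gdist_step[OF assms(1)] gdist_step'[OF assms(1)] assms(2) by (meson leD)

text \<open>On a shortest path of length 6 from \<open>u\<close>, the vertices at distances 0, 1, 3,
  4 and 6 induce the forbidden graph.\<close>

lemma gdist_le_5:
  assumes u: "u \<in> V" and v: "v \<in> V"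
  shows "d u v \<le> 5"
proof (rule ccontr)
  assume "\<not> d u v \<le> 5"
  then have "6 \<le> d u v" by simp
  \<comment> \<open>Stepping back from \<open>v\<close> by predecessors meets every smaller
    distance, in particular 6.\<close>
  moreover have "\<exists>y\<in>V. d u y = k" if "k \<le> d u v" for k
    using that
  proof (induction rule: inc_induct)
    case base
    then show ?case using v by blast
  next
    case (step k)
    then show ?case using gdist_pred[OF u] adjacentD(1) by metis
  qed
  ultimately obtain x6 where x6: "x6 \<in> V" "d u x6 = 6" by blast
  obtain x5 where x5: "x5 \<sim> x6" "d u x5 = 5" using gdist_pred[OF u x6(1), of 5] x6 by auto
  obtain x4 where x4: "x4 \<sim> x5" "d u x4 = 4" using gdist_pred[OF u adjacentD(1)[OF x5(1)], of 4] x5 by auto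
  obtain x3 where x3: "x3 \<sim> x4" "d u x3 = 3" using gdist_pred[OF u adjacentD(1)[OF x4(1)], of 3] x4 by auto
  obtain x2 where x2: "x2 \<sim> x3" "d u x2 = 2" using gdist_pred[OF u adjacentD(1)[OF x3(1)], of 2] x3 by auto
  obtain x1 where x1: "x1 \<sim> x2" "d u x1 = 1" using gdist_pred[OF u adjacentD(1)[OF x2(1)], of 1] x2 by auto
  have "u \<sim> x1" using x1 gdist_1[OF u adjacentD(1)[OF x1(1)]] by simp
  then show False
    by (rule no_2P2_P1[OF _ x3(1) x6(1)]; intro nonadjacent[OF u])
       (use x1 x3 x4 x6 gdist_same[OF u] in auto)
qed

text \<open>Otherwise the end edges \<open>x1 u\<close> and \<open>x4 v\<close> of shortest paths
  between \<open>u\<close> and \<open>v\<close>, with \<open>w\<close> as the isolated vertex,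
  induce the forbidden graph.\<close>

lemma near_diametral_pair:
  assumes u: "u \<in> V" and v: "v \<in> V" and uv: "d u v = 5" and w: "w \<in> V"
  shows "d w u \<le> 2 \<or> d w v \<le> 2"
proof (rule ccontr)
  assume far: "\<not> ?thesis"
  obtain x4 where x4: "x4 \<sim> v" "d u x4 = 4" using gdist_pred[OF u v, of 4] uv by auto
  obtain x1 where x1: "x1 \<sim> u" "d v x1 = 4"
    using gdist_pred[OF v u, of 4] uv gdist_commute[OF u v] by auto
  have V: "x1 \<in> V" "x4 \<in> V" using adjacentD x1 x4 by blast+
  have "d w x1 \<ge> 2" "d w x4 \<ge> 2" using far gdist_step[OF w x1(1)] gdist_step[OF w x4(1)] by auto
  then have nw: "\<not> w \<sim> x1" "\<not> w \<sim> u" "\<not> w \<sim> x4" "\<not> w \<sim> v"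
    using far by (auto dest: gdist_adjacent)
  have "d u x1 = 1" using gdist_adjacent adjacentD(4)[OF x1(1)] by simp
  then show False
    by (intro no_2P2_P1[OF x1(1) x4(1) w _ _ _ _ nw] nonadjacent[OF u])
       (use x4 uv gdist_same[OF u] in auto)
qed

text \<open>Here \<open>z\<close> satisfies \<open>N(z) \<subseteq> N(v)\<close>.\<close>

lemma last_layer_4:
  assumes u: "u \<in> V" and v: "v \<in> V" and uv: "d u v = 5"
    and w: "w \<in> V" "\<And>x. x \<in> V \<Longrightarrow> d w x \<le> 4" and wv: "d w v = 4"
    and z: "z \<in> V" "d w z = 4"
  shows "d u z = 5"
proof -
  have wu: "d w u \<le> 2" using near_diametral_pair[OF u v uv w(1)] wv by simp
  have "u \<noteq> w" using uv wv by auto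
  then have wu0: "d w u \<noteq> 0" using gdist_eq_0[OF w(1) u] by simp
  \<comment> \<open>\<open>a\<close> is \<open>u\<close> itself, or the middle vertex of a shortest
    path from \<open>w\<close> to \<open>u\<close> of length 2.\<close>
  obtain a where a: "w \<sim> a" "d u a \<le> 1"
  proof (cases "d w u = 1")
    case True
    then show ?thesis using gdist_1[OF w(1) u] that[of u] gdist_same[OF u] by simp
  next
    case False
    then have "d w u = Suc 1" using wu wu0 by simp
    then obtain a where "a \<sim> u" "d w a = 1" using gdist_pred[OF w(1) u] by blast
    then show ?thesis using that[of a] gdist_1[OF w(1)] adjacentD[of a u] gdist_adjacent[of u a] by auto
  qed
  have wa: "d w a = 1" using a gdist_adjacent by simp
  obtain b3 where b3: "b3 \<sim> v" "d w b3 = 3" using gdist_pred[OF w(1) v, of 3] wv by auto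
  obtain b2 where b2: "b2 \<sim> b3" "d w b2 = 2"
    using gdist_pred[OF w(1) adjacentD(1)[OF b3(1)], of 2] b3 by auto
  have "d u b2 \<ge> 3" using gdist_step[OF u b2(1)] gdist_step[OF u b3(1)] uv by simp
  then have b2a: "\<not> b2 \<sim> a" using a by (intro nonadjacent[OF u]) auto
  \<comment> \<open>Otherwise take the edges \<open>w a\<close> and \<open>z v\<close> with
    \<open>b2\<close> isolated: it lies in layer 2 of \<open>w\<close>, and is too far from
    \<open>u\<close> to be adjacent to \<open>a\<close>.\<close>
  have zv: "\<not> z \<sim> v"
  proof
    assume "z \<sim> v"
    then show False
      by (rule no_2P2_P1[OF a(1) _ adjacentD(1)[OF b2(1)] _ _ _ _ _ b2a]; intro nonadjacent[OF w(1)])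
         (use wa z wv b2 gdist_same[OF w(1)] in auto)
  qed
  \<comment> \<open>Otherwise take the edges \<open>w a\<close> and \<open>y z\<close> with
    \<open>v\<close> isolated.\<close>
  have sub: "y \<sim> v" if "y \<sim> z" for y
  proof (rule ccontr)
    assume n: "\<not> y \<sim> v"
    have "d w y \<ge> 3" using gdist_step[OF w(1) that] z by simp
    then show False
      by (intro no_2P2_P1[OF a(1) that v _ _ _ _ _ _ n[unfolded adjacent_sym[of y]]
            zv[unfolded adjacent_sym[of z]]] nonadjacent[OF w(1)])
         (use wa z wv gdist_same[OF w(1)] in auto)
  qed
  have "d u z \<noteq> 0" using gdist_eq_0[OF u z(1)] wu z(2) by auto
  \<comment> \<open>The predecessor \<open>y\<close> of \<open>z\<close>, seen from
    \<open>u\<close>, is also adjacent to \<open>v\<close>, so \<open>z\<close> is at least as far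
    from \<open>u\<close> as \<open>v\<close> is.\<close>
  then obtain y where y: "y \<sim> z" "d u z = Suc (d u y)"
    using gdist_pred[OF u z(1)] by (metis not0_implies_Suc)
  have "d u z \<ge> 5" using gdist_step[OF u sub[OF y(1)]] uv y by simp
  then show ?thesis using gdist_le_5[OF u z(1)] by simp
qed

text \<open>If \<open>z\<close> had distance at most 3 from \<open>u\<close>, the last edge
  \<open>c z\<close> of a shortest path from \<open>u\<close> would avoid the neighbours of
  \<open>v\<close>. With the edge from \<open>w\<close> to the middle vertex \<open>x1\<close> of a
  path to \<open>u\<close>, and \<open>v\<close> isolated, it would induce the forbidden
  graph.\<close>

lemma last_layer_4':
  assumes u: "u \<in> V" and v: "v \<in> V" and uv: "d u v = 5"
    and w: "w \<in> V" and wu: "d w u = 2" and wv: "d w v = 3"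
    and z: "z \<in> V" "d w z = 4"
  shows "d u z \<ge> 4"
proof (rule ccontr)
  assume "\<not> ?thesis"
  then have uz: "d u z \<le> 3" by simp
  have "d u z \<noteq> 0" using gdist_eq_0[OF u z(1)] wu z(2) by auto
  then obtain c where c: "c \<sim> z" "d u z = Suc (d u c)"
    using gdist_pred[OF u z(1)] by (metis not0_implies_Suc)
  obtain x1 where x1: "x1 \<sim> u" "d w x1 = 1" using gdist_pred[OF w u, of 1] wu by auto
  have wx1: "w \<sim> x1" using x1 adjacentD(1)[OF x1(1)] gdist_1[OF w] by simp
  have "d w c \<ge> 3" using gdist_step[OF w c(1)] z by simp
  then have n: "\<not> w \<sim> c" "\<not> w \<sim> z" "\<not> x1 \<sim> c" "\<not> x1 \<sim> z" "\<not> v \<sim> w" "\<not> v \<sim> x1"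
    by (intro nonadjacent[OF w]; use x1 z wv gdist_same[OF w] in simp)+
  have "\<not> v \<sim> c" "\<not> v \<sim> z"
    by (intro nonadjacent[OF u]; use uz c uv in simp)+
  then show False using no_2P2_P1[OF wx1 c(1) v n] by blast
qed

text \<open>If \<open>z\<close> is not adjacent to \<open>v\<close>, then \<open>N(v) \<subseteq> N(z)\<close>, and the degree condition turns this
  into an equality.\<close>

lemma last_layer_3:
  assumes u: "u \<in> V" and v: "v \<in> V" and uv: "d u v = 5"
    and w: "w \<in> V" and wu: "d w u = 2" and wv: "d w v = 3"
    and z: "z \<in> V" "d w z = 3"
    and deg: "card (neighbours G z) \<le> card (neighbours G v)"
  shows "d u z \<ge> 4"
proof (cases "z \<sim> v")
  case True
  then show ?thesis using gdist_step[OF u True] uv by simp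
next
  case zv: False
  obtain x1 where x1: "x1 \<sim> u" "d w x1 = 1" using gdist_pred[OF w u, of 1] wu by auto
  have ux1: "d u x1 = 1" using x1 adjacentD(4)[OF x1(1)] gdist_adjacent by simp
  obtain b where b: "b \<sim> v" "d w b = 2" using gdist_pred[OF w v, of 2] wv by auto
  have uy: "d u y \<ge> 4" if "y \<sim> v" for y using gdist_step[OF u that] uv by simp
  have zx1: "\<not> z \<sim> x1" by (rule nonadjacent[OF w]) (use z x1 in simp)
  \<comment> \<open>Otherwise take the edges \<open>z u\<close> and \<open>b v\<close> with
    \<open>w\<close> isolated.\<close>
  have zu: "\<not> z \<sim> u"
  proof
    assume zu: "z \<sim> u"
    have uz: "d u z = 1" using adjacentD(4)[OF zu] gdist_adjacent by simp
    have "\<not> z \<sim> b" "\<not> z \<sim> v" "\<not> u \<sim> b" "\<not> u \<sim> v"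
      by (intro nonadjacent[OF u]; use uz uy[OF b(1)] uv gdist_same[OF u] in simp)+
    moreover have "\<not> w \<sim> z" "\<not> w \<sim> u" "\<not> w \<sim> b" "\<not> w \<sim> v"
      by (intro nonadjacent[OF w]; use wu wv z b gdist_same[OF w] in simp)+
    ultimately show False using no_2P2_P1[OF zu b(1) w] by blast
  qed
  have "neighbours G v \<subseteq> neighbours G z"
  proof
    fix y assume "y \<in> neighbours G v"
    then have yv: "y \<sim> v" by (simp add: neighbours_def insert_commute)
    \<comment> \<open>Otherwise take the edges \<open>x1 u\<close> and \<open>y v\<close> with
      \<open>z\<close> isolated.\<close>
    have "z \<sim> y"
    proof (rule ccontr)
      assume "\<not> z \<sim> y"
      moreover have "\<not> x1 \<sim> y" "\<not> x1 \<sim> v" "\<not> u \<sim> y" "\<not> u \<sim> v"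
        by (intro nonadjacent[OF u]; use uy[OF yv] uv ux1 gdist_same[OF u] in simp)+
      ultimately show False using no_2P2_P1[OF x1(1) yv z(1)] zx1 zu zv by blast
    qed
    then show "y \<in> neighbours G z" by (simp add: neighbours_def)
  qed
  then have N: "neighbours G v = neighbours G z"
    using deg finite_neighbours card_seteq by metis
  have "d u z \<noteq> 0" using gdist_eq_0[OF u z(1)] wu z(2) by auto
  then obtain y where y: "y \<sim> z" "d u z = Suc (d u y)"
    using gdist_pred[OF u z(1)] by (metis not0_implies_Suc)
  have "z \<sim> y" using y adjacentD by blast
  then have "y \<in> neighbours G v" using N by (simp add: neighbours_def)
  then have "y \<sim> v" by (simp add: neighbours_def insert_commute)
  then show ?thesis using uy[of y] y by simp
qed

section \<open>Correctness of the sweeps\<close>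

definition farthest :: "'a \<Rightarrow> 'a \<Rightarrow> bool" where
  "farthest w z \<longleftrightarrow> z \<in> V \<and> (\<forall>x\<in>V. d w x \<le> d w z \<and>
     (d w x = d w z \<longrightarrow> card (neighbours G z) \<le> card (neighbours G x)))"

text \<open>The pair is oriented so that \<open>w\<close> is near \<open>u\<close>. The vertex at
  distance 5 from \<open>y\<close> is \<open>z\<close> if the second sweep finds distance 5, and
  \<open>v\<close> otherwise.\<close>

lemma two_sweeps_aux:
  assumes u: "u \<in> V" and v: "v \<in> V" and uv: "d u v = 5" and w: "w \<in> V"
    and wu: "d w u \<le> 2" and z: "farthest w z" and y: "farthest z y" and wz: "d w z \<noteq> 5"
  shows "\<exists>x\<in>V. d x y = 5"
proof -
  have zV: "z \<in> V" and yV: "y \<in> V" using z y by (auto simp: farthest_def)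
  have ecc: "d z y = 5" if "x \<in> V" "d z x = 5" for x
    using y that gdist_le_5[OF zV yV] unfolding farthest_def by force
  have wz4: "d w z \<le> 4" using gdist_le_5[OF w zV] wz by simp
  then have w4: "d w x \<le> 4" if "x \<in> V" for x using z that unfolding farthest_def by force
  have wv: "d w v \<ge> 3" using gdist_triangle[OF u w v] uv wu gdist_commute[OF u w] by simp
  show ?thesis
  proof (cases "d w v = 4")
    case True
    then have "d w z = 4" using wz4 z v unfolding farthest_def by force
    then have "d u z = 5" using last_layer_4[OF u v uv w w4 True zV] by simp
    then show ?thesis using ecc[OF u] gdist_commute[OF u zV] zV by auto
  next
    case False
    then have wv3: "d w v = 3" using wv w4[OF v] by simp
    then have wu2: "d w u = 2"
      using gdist_triangle[OF u w v] uv wu gdist_commute[OF u w] by simp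
    have "d u z \<ge> 4"
    proof (cases "d w z = 4")
      case True
      then show ?thesis using last_layer_4'[OF u v uv w wu2 wv3 zV] by simp
    next
      case False
      then have wz3: "d w z = 3" using z v wv3 wz4 unfolding farthest_def by force
      then show ?thesis using last_layer_3[OF u v uv w wu2 wv3 zV wz3] z v wv3
        unfolding farthest_def by auto
    qed
    then have zu: "d z u \<ge> 4" using gdist_commute[OF u zV] by simp
    show ?thesis
    proof (cases "d z y = 5")
      case True
      then show ?thesis using zV by blast
    next
      case False
      then have z4: "d z x \<le> 4" if "x \<in> V" for x
        using ecc[OF that] gdist_le_5[OF zV that] by (cases "d z x = 5") auto
      have zu4: "d z u = 4" using z4[OF u] zu by simp
      then have "d z y = 4" using z4[OF yV] y u unfolding farthest_def by force
      \<comment> \<open>\<open>last_layer_4\<close> with \<open>u\<close> and \<open>v\<close>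
        exchanged, \<open>z\<close> as the source and \<open>y\<close> in its last layer.\<close>
      then have "d v y = 5"
        using last_layer_4[OF v u _ zV z4 zu4 yV] uv gdist_commute[OF u v] by simp
      then show ?thesis using v by blast
    qed
  qed
qed

text \<open>If the first sweep already finds distance 5, then \<open>z\<close> has eccentricity 5
  and the second sweep finds it again. Otherwise \<open>near_diametral_pair\<close> decides which of
  \<open>u\<close> and \<open>v\<close> is the near end in \<open>two_sweeps_aux\<close>.\<close>

lemma diam_5_iff_farthest:
  assumes w: "w \<in> V" and z: "farthest w z" and y: "farthest z y" and x: "farthest y x"
  shows "diam G = 5 \<longleftrightarrow> d y x = 5"
proof
  have V: "z \<in> V" "y \<in> V" "x \<in> V" using z y x by (auto simp: farthest_def)
  show "diam G = 5" if "d y x = 5"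
  proof -
    have "diam G \<le> 5" by (metis diam_witness gdist_le_5)
    then show ?thesis using gdist_le_diam[OF V(2,3)] that by simp
  qed
  assume "diam G = 5"
  then obtain u v where uv: "u \<in> V" "v \<in> V" "d u v = 5" by (metis diam_witness)
  have "\<exists>x\<in>V. d x y = 5"
  proof (cases "d w z = 5")
    case True
    then have "d z w = 5" using gdist_commute[OF w V(1)] by simp
    then have "d z y = 5" using y w gdist_le_5[OF V(1,2)] unfolding farthest_def by force
    then show ?thesis using V by blast
  next
    case False
    then show ?thesis
      using near_diametral_pair[OF uv w] two_sweeps_aux[OF uv w _ z y]
        two_sweeps_aux[OF uv(2,1) _ w _ z y] uv gdist_commute[OF uv(1,2)] by metis
  qed
  then obtain x' where "x' \<in> V" "d x' y = 5" by blast
  then have "d y x' = 5" using gdist_commute V by metis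
  then show "d y x = 5" using x \<open>x' \<in> V\<close> gdist_le_5[OF V(2,3)] unfolding farthest_def by force
qed

end

section \<open>The maximum diameter\<close>

definition P6 :: "nat graph" where
  "P6 = ({..<6}, {{i, Suc i} | i. i < 5})"

lemma P6_edge: "{x, y} \<in> edges P6 \<longleftrightarrow> x < 6 \<and> y < 6 \<and> (y = Suc x \<or> x = Suc y)"
  by (auto simp: P6_def doubleton_eq_iff)

lemma simple_graph_P6: "simple_graph P6"
  by (auto simp: simple_graph_def P6_def)

lemma connected_graph_P6: "connected_graph P6"
proof -
  have *: "is_path P6 u [u..<Suc v] v" if "u \<le> v" "v < 6" for u v
    using that by (auto simp: is_path_def P6_edge successively_conv_nth P6_def[THEN arg_cong, of fst]
        simp del: upt_Suc)
  have rev: "is_path P6 v (rev xs) u" if "is_path P6 u xs v" for u v xs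
    using that by (auto simp: is_path_def hd_rev last_rev insert_commute)
  have "\<exists>xs. is_path P6 u xs v" if "u < 6" "v < 6" for u v
    using * rev that by (metis linear)
  moreover have "verts P6 = {..<6}" by (simp add: P6_def)
  ultimately show ?thesis by (auto simp: connected_graph_def lessThan_empty_iff)
qed

lemma P6_edge_cases:
  assumes "{x, y} \<in> edges P6"
  obtains i where "i < 5" "x = i \<and> y = Suc i \<or> x = Suc i \<and> y = i"
  using assms that by (auto simp: P6_edge)

text \<open>On a path, two edges and a vertex without adjacencies between them occupy at least 2 + 2
  + 1 positions plus two gaps, that is 7 instead of 6.\<close>

lemma free_of_P6: "free_of graph_2P2_P1 P6"
proof (rule ccontr)
  assume "\<not> ?thesis"
  then obtain a b c d e where *:
    "{a, b} \<in> edges P6" "{c, d} \<in> edges P6" "e \<in> verts P6"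
    "{a, c} \<notin> edges P6" "{a, d} \<notin> edges P6" "{b, c} \<notin> edges P6" "{b, d} \<notin> edges P6"
    "{e, a} \<notin> edges P6" "{e, b} \<notin> edges P6" "{e, c} \<notin> edges P6" "{e, d} \<notin> edges P6"
    "a \<noteq> c" "a \<noteq> d" "b \<noteq> c" "b \<noteq> d"
    by (rule graph_iso_2P2_P1_D)
  have e: "e < 6" using *(3) by (simp add: P6_def)
  obtain i where i: "i < 5" "a = i \<and> b = Suc i \<or> a = Suc i \<and> b = i"
    using *(1) by (rule P6_edge_cases)
  obtain j where j: "j < 5" "c = j \<and> d = Suc j \<or> c = Suc j \<and> d = j"
    using *(2) by (rule P6_edge_cases)
  have apart: "i \<noteq> j" "i \<noteq> Suc j" "Suc i \<noteq> j" "{Suc i, j} \<notin> edges P6" "{i, Suc j} \<notin> edges P6"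
    using i(2) j(2) *(4-7,12-) by auto
  have far: "i + 3 \<le> j \<or> j + 3 \<le> i"
    using apart i(1) j(1) unfolding P6_edge by presburger
  have ei: "{e, i} \<notin> edges P6" "{e, Suc i} \<notin> edges P6" "{e, j} \<notin> edges P6" "{e, Suc j} \<notin> edges P6"
    using i(2) j(2) *(8-11) by auto
  have "e + 2 \<le> i \<or> i + 3 \<le> e" using ei(1,2) e i(1) unfolding P6_edge by presburger
  moreover have "e + 2 \<le> j \<or> j + 3 \<le> e" using ei(3,4) e j(1) unfolding P6_edge by presburger
  ultimately show False using far e i(1) j(1) by linarith
qed
lemma diam_P6: "diam P6 = 5"
proof -
  interpret connected_2P2_P1_free_graph P6
    by unfold_locales (fact simple_graph_P6 connected_graph_P6 free_of_P6)+
  have V: "0 \<in> verts P6" "5 \<in> verts P6" by (simp_all add: P6_def)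
  \<comment> \<open>Each step of a walk raises the vertex number by at most one.\<close>
  have "v \<le> k" if "(0, v) \<in> adjacency P6 ^^ k" for k v
    using that by (induction k arbitrary: v) (fastforce simp: adjacency_def P6_edge)+
  then have "5 \<le> gdist P6 0 5" using gdist_relpow[OF V] by blast
  then have "5 \<le> diam P6" using gdist_le_diam[OF V] by simp
  moreover have "diam P6 \<le> 5" by (metis diam_witness gdist_le_5)
  ultimately show ?thesis by simp
qed

lemma d_max_2P2_P1: "d_max graph_2P2_P1 = 5"
  unfolding d_max_def
proof (rule antisym)
  show "(SUP G \<in> {G :: nat graph. simple_graph G \<and> connected_graph G \<and> free_of graph_2P2_P1 G}.
     enat (diam G)) \<le> 5"
  proof (rule SUP_least)
    fix G :: "nat graph"
    assume "G \<in> {G. simple_graph G \<and> connected_graph G \<and> free_of graph_2P2_P1 G}"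
    then interpret connected_2P2_P1_free_graph G by unfold_locales auto
    have "diam G \<le> 5" by (metis diam_witness gdist_le_5)
    then show "enat (diam G) \<le> 5" by (simp add: numeral_eq_enat)
  qed
  have "enat (diam P6) \<le> (SUP G \<in> {G :: nat graph. simple_graph G \<and> connected_graph G \<and> free_of graph_2P2_P1 G}.
     enat (diam G))"
    by (rule SUP_upper) (simp add: simple_graph_P6 connected_graph_P6 free_of_P6)
  then show "5 \<le> (SUP G \<in> {G :: nat graph. simple_graph G \<and> connected_graph G \<and> free_of graph_2P2_P1 G}.
     enat (diam G))"
    by (simp add: diam_P6 numeral_eq_enat)
qed

section \<open>Running times of structured programs\<close>

text \<open>The semantics of loop-free programs as a function, so that loop bodies are evaluated by
  simplification.\<close>

fun prun :: "prog \<Rightarrow> state \<Rightarrow> state" where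
  "prun SKIP s = s"
| "prun (Assign x a) s = ((fst s)(x := aval s a), snd s)"
| "prun (Write A i a) s = (fst s, (snd s)(A := (snd s A)(aval s i := aval s a)))"
| "prun (Seq p q) s = prun q (prun p s)"
| "prun (IF b p q) s = (if bval s b then prun p s else prun q s)"
| "prun (WHILE b p) s = s"

text \<open>An upper bound independent of the state: a conditional pays for both branches.\<close>

fun pcost :: "prog \<Rightarrow> nat" where
  "pcost SKIP = 1"
| "pcost (Assign x a) = acost a + 1"
| "pcost (Write A i a) = acost i + acost a + 1"
| "pcost (Seq p q) = pcost p + pcost q"
| "pcost (IF b p q) = bcost b + 1 + pcost p + pcost q"
| "pcost (WHILE b p) = 0"

text \<open>Loops are excluded here: \<^const>\<open>prun\<close> and \<^const>\<open>pcost\<close> are meaningless for them.\<close>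

fun pfits :: "nat \<Rightarrow> prog \<Rightarrow> state \<Rightarrow> bool" where
  "pfits W SKIP s \<longleftrightarrow> True"
| "pfits W (Assign x a) s \<longleftrightarrow> afits W s a"
| "pfits W (Write A i a) s \<longleftrightarrow> afits W s i \<and> afits W s a"
| "pfits W (Seq p q) s \<longleftrightarrow> pfits W p s \<and> pfits W q (prun p s)"
| "pfits W (IF b p q) s \<longleftrightarrow> bfits W s b \<and> (if bval s b then pfits W p s else pfits W q s)"
| "pfits W (WHILE b p) s \<longleftrightarrow> False"

text \<open>A total-correctness triple with time bound \<open>T\<close> and word bound
  \<open>W\<close>.\<close>

definition runs :: "nat \<Rightarrow> prog \<Rightarrow> state \<Rightarrow> nat \<Rightarrow> (state \<Rightarrow> bool) \<Rightarrow> bool" where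
  "runs W p s T Q \<longleftrightarrow> (\<exists>t s'. exec W p s t s' \<and> t \<le> T \<and> Q s')"

lemma runsI: "exec W p s t s' \<Longrightarrow> t \<le> T \<Longrightarrow> Q s' \<Longrightarrow> runs W p s T Q"
  unfolding runs_def by blast

lemma runs_mono: "runs W p s T Q \<Longrightarrow> T \<le> T' \<Longrightarrow> (\<And>s'. Q s' \<Longrightarrow> Q' s') \<Longrightarrow> runs W p s T' Q'"
  unfolding runs_def by (meson order_trans)

lemma runs_Seq:
  assumes "runs W p s T Q" "\<And>s'. Q s' \<Longrightarrow> runs W q s' T' R"
  shows "runs W (Seq p q) s (T + T') R"
proof -
  obtain t s1 where p: "exec W p s t s1" "t \<le> T" "Q s1" using assms(1) by (auto simp: runs_def)
  obtain t' s2 where q: "exec W q s1 t' s2" "t' \<le> T'" "R s2"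
    using assms(2)[OF p(3)] by (auto simp: runs_def)
  show ?thesis unfolding runs_def
    by (intro exI conjI) (rule exec.Seq[OF p(1) q(1)], use p q in auto)
qed

lemma runs_loop_free: "pfits W p s \<Longrightarrow> runs W p s (pcost p) (\<lambda>s'. s' = prun p s)"
proof (induction p arbitrary: s)
  case (Seq p q)
  then have "runs W (Seq p q) s (pcost p + pcost q) (\<lambda>s'. s' = prun q (prun p s))"
    by (intro runs_Seq[where Q = "\<lambda>s'. s' = prun p s"]) auto
  then show ?case by simp
next
  case (IF b p q)
  show ?case
  proof (cases "bval s b")
    case True
    then have "runs W p s (pcost p) (\<lambda>s'. s' = prun p s)" using IF by auto
    then obtain t where "exec W p s t (prun p s)" "t \<le> pcost p" by (auto simp: runs_def)
    then show ?thesis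
      by (intro runsI[OF exec.IfTrue]) (use True IF.prems in auto)
  next
    case False
    then have "runs W q s (pcost q) (\<lambda>s'. s' = prun q s)" using IF by auto
    then obtain t where "exec W q s t (prun q s)" "t \<le> pcost q" by (auto simp: runs_def)
    then show ?thesis
      by (intro runsI[OF exec.IfFalse]) (use False IF.prems in auto)
  qed
qed (auto intro!: runsI[OF exec.Skip] runsI[OF exec.Assign] runsI[OF exec.Write])

text \<open>\<open>pfits\<close> forces the body to be loop-free, so its cost has a fixed bound; the
  \<open>Suc\<close> pays for the final failing test.\<close>

lemma runs_WHILE:
  fixes \<mu> :: "state \<Rightarrow> nat"
  assumes "I s" "\<And>s. I s \<Longrightarrow> bfits W s b"
    "\<And>s. I s \<Longrightarrow> bval s b \<Longrightarrow> pfits W p s \<and> I (prun p s) \<and> \<mu> (prun p s) < \<mu> s"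
  shows "runs W (WHILE b p) s (Suc (\<mu> s) * (bcost b + 1 + pcost p)) (\<lambda>s'. I s' \<and> \<not> bval s' b)"
  using assms(1)
proof (induction "\<mu> s" arbitrary: s rule: less_induct)
  case less
  show ?case
  proof (cases "bval s b")
    case False
    then show ?thesis
      by (intro runsI[OF exec.WhileFalse[OF assms(2)[OF less.prems] False]]) (use less.prems in auto)
  next
    case True
    have step: "pfits W p s" "I (prun p s)" "\<mu> (prun p s) < \<mu> s" using assms(3)[OF less.prems True] by auto
    obtain t where t: "exec W p s t (prun p s)" "t \<le> pcost p"
      using runs_loop_free[OF step(1)] by (auto simp: runs_def)
    obtain t' s' where t': "exec W (WHILE b p) (prun p s) t' s'" "I s' \<and> \<not> bval s' b"
      "t' \<le> Suc (\<mu> (prun p s)) * (bcost b + 1 + pcost p)"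
      using less.hyps[OF step(3,2)] unfolding runs_def by blast
    have "t' \<le> \<mu> s * (bcost b + 1 + pcost p)"
      using t'(3) step(3) by (meson Suc_leI mult_le_mono1 order_trans)
    then have "bcost b + 1 + t + t' \<le> Suc (\<mu> s) * (bcost b + 1 + pcost p)" using t(2) by simp
    then show ?thesis
      using exec.WhileTrue[OF assms(2)[OF less.prems] True t(1) t'(1)] t'(2) unfolding runs_def by blast
  qed
qed


section \<open>The program\<close>

text \<open>Registers: 0 number of vertices, 2 current vertex, 3 current index into the adjacency
  array, 4 source of the search and later its farthest vertex. The array \<open>D\<close> holds distances
  plus 1, where 0 means not yet reached. A scan of all adjacency lists extends \<open>D\<close> by one layer,
  and as distances are at most 5, five scans replace a queue.\<close>

definition scan_body :: "nat \<Rightarrow> nat \<Rightarrow> prog" where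
  "scan_body D k = IF (Less (Reg 3) (Read 0 (Plus (Reg 2) (Const 1))))
     (Seq (IF (Conj (Equal (Read D (Reg 2)) (Const k)) (Equal (Read D (Read 1 (Reg 3))) (Const 0)))
            (Write D (Read 1 (Reg 3)) (Const (Suc k))) SKIP)
          (Assign 3 (Plus (Reg 3) (Const 1))))
     (Assign 2 (Plus (Reg 2) (Const 1)))"

text \<open>A single loop replaces the nested loops over vertices and their lists: an iteration
  either handles one entry or moves on to the next vertex.\<close>

definition scan :: "nat \<Rightarrow> nat \<Rightarrow> prog" where
  "scan D k = Seq (Seq (Assign 2 (Const 0)) (Assign 3 (Const 0)))
     (WHILE (Less (Reg 2) (Reg 0)) (scan_body D k))"

definition degree_exp :: "nat \<Rightarrow> aexp" where
  "degree_exp r = Minus (Read 0 (Plus (Reg r) (Const 1))) (Read 0 (Reg r))"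

text \<open>\<open>bexp\<close> has no disjunction, so "greater distance, or equal distance and
  smaller degree" is written by De Morgan.\<close>

definition select_body :: "nat \<Rightarrow> prog" where
  "select_body D = Seq
     (IF (Neg (Conj (Neg (Less (Read D (Reg 4)) (Read D (Reg 2))))
                    (Neg (Conj (Equal (Read D (Reg 4)) (Read D (Reg 2)))
                               (Less (degree_exp 2) (degree_exp 4))))))
       (Assign 4 (Reg 2)) SKIP)
     (Assign 2 (Plus (Reg 2) (Const 1)))"

definition select :: "nat \<Rightarrow> prog" where
  "select D = Seq (Seq (Assign 2 (Const 0)) (Assign 4 (Const 0)))
     (WHILE (Less (Reg 2) (Reg 0)) (select_body D))"

definition sweep :: "nat \<Rightarrow> prog" where
  "sweep D = Seq (Write D (Reg 4) (Const 1))
     (Seq (scan D 1) (Seq (scan D 2) (Seq (scan D 3) (Seq (scan D 4) (Seq (scan D 5) (select D))))))"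

text \<open>Each sweep has its own array, still zero, so nothing is cleared. The last sweep measures
  the eccentricity of \<open>y\<close>; 6 encodes distance 5.\<close>

definition diam_prog :: prog where
  "diam_prog = Seq (sweep 2) (Seq (sweep 3) (Seq (sweep 4)
     (IF (Equal (Read 4 (Reg 4)) (Const 6)) (Assign 0 (Const 1)) (Assign 0 (Const 0)))))"

section \<open>The adjacency lists in memory\<close>

locale graph_input = connected_2P2_P1_free_graph G for G :: "nat graph" +
  fixes adj :: "nat list list"
  assumes adj: "adj_lists G adj"
begin

definition n where "n = length adj"
definition M where "M = length (concat adj)"
definition off where "off v = length (concat (take v adj))"
definition ends where "ends i = concat adj ! i"

lemma V_eq: "V = {..<n}"
  using adj by (simp add: adj_lists_def n_def)

lemma n_pos: "0 < n"
  using V_nonempty by (auto simp: V_eq)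

lemma off_0: "off 0 = 0"
  by (simp add: off_def)

lemma off_Suc: "v < n \<Longrightarrow> off (Suc v) = off v + length (adj ! v)"
  by (simp add: off_def n_def take_Suc_conv_app_nth)

lemma off_n: "off n = M"
  by (simp add: off_def n_def M_def)

lemma off_mono: "v \<le> v' \<Longrightarrow> v' \<le> n \<Longrightarrow> off v \<le> off v'"
  by (induction v' rule: dec_induct) (auto simp: off_Suc)

lemma off_le_M: "v \<le> n \<Longrightarrow> off v \<le> M"
  using off_mono[of v n] off_n by simp

lemma ends_nth:
  assumes "v < n" "off v \<le> i" "i < off (Suc v)"
  shows "ends i = adj ! v ! (i - off v)"
proof -
  have "adj = take v adj @ adj ! v # drop (Suc v) adj"
    using assms(1) by (intro id_take_nth_drop) (simp add: n_def)
  then have "concat adj = concat (take v adj @ adj ! v # drop (Suc v) adj)" by (rule arg_cong)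
  also have "\<dots> = concat (take v adj) @ adj ! v @ concat (drop (Suc v) adj)" by simp
  finally have "ends i = (concat (take v adj) @ adj ! v @ concat (drop (Suc v) adj)) ! i"
    unfolding ends_def by (rule arg_cong)
  moreover have "\<not> i < length (concat (take v adj))"
    "i - length (concat (take v adj)) < length (adj ! v)"
    using assms off_Suc[OF assms(1)] unfolding off_def by linarith+
  ultimately show ?thesis by (simp only: nth_append off_def if_False if_True)
qed

lemma ends_image:
  assumes "v < n"
  shows "ends ` {off v..<off (Suc v)} = neighbours G v"
proof -
  have "ends ` {off v..<off (Suc v)} = (\<lambda>i. adj ! v ! (i - off v)) ` {off v..<off v + length (adj ! v)}"
    using ends_nth[OF assms] by (auto simp: off_Suc[OF assms])
  also have "\<dots> = set (adj ! v)"
  proof -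
    have *: "{off v..<off v + length (adj ! v)} = (\<lambda>j. j + off v) ` {0..<length (adj ! v)}"
      by (simp add: add.commute)
    show ?thesis unfolding * image_image by (simp add: nth_image)
  qed
  finally show ?thesis using adj assms by (simp add: adj_lists_def neighbours_def n_def)
qed

lemma card_neighbours:
  assumes "v < n"
  shows "card (neighbours G v) = off (Suc v) - off v"
proof -
  have "neighbours G v = set (adj ! v)" "distinct (adj ! v)"
    using adj assms by (auto simp: adj_lists_def neighbours_def n_def)
  then show ?thesis by (simp add: off_Suc[OF assms] distinct_card)
qed

text \<open>Double counting of ordered adjacent pairs: each edge comes from at most two of
  them.\<close>

lemma M_le: "M \<le> 2 * card (edges G)"
proof -
  have finE: "finite (edges G)"
    using simple finite_subset[of "edges G" "Pow V"] by (auto simp: simple_graph_def)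
  have "M = (\<Sum>v<n. card (neighbours G v))"
  proof -
    have "off v = (\<Sum>v<v. card (neighbours G v))" if "v \<le> n" for v
      using that by (induction v) (auto simp: off_0 card_neighbours off_Suc)
    then show ?thesis using off_n by force
  qed
  also have "\<dots> = card (Sigma {..<n} (neighbours G))"
    by (simp add: finite_neighbours)
  also have "\<dots> \<le> card (\<Union>e\<in>edges G. {(x, y). {x, y} = e})"
  proof (rule card_mono)
    show "finite (\<Union>e\<in>edges G. {(x, y). {x, y} = e})"
    proof (rule finite_subset)
      show "(\<Union>e\<in>edges G. {(x, y). {x, y} = e}) \<subseteq> V \<times> V" using adjacentD(1,2) by blast
    qed (simp add: finite_V)
  qed (auto simp: neighbours_def)
  also have "\<dots> \<le> (\<Sum>e\<in>edges G. card {(x, y). {x, y} = e})"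
    by (rule card_UN_le[OF finE])
  also have "\<dots> \<le> (\<Sum>e\<in>edges G. 2)"
  proof (rule sum_mono)
    fix e assume "e \<in> edges G"
    then obtain a b where e: "e = {a, b}" using simple by (auto simp: simple_graph_def card_2_iff)
    have "{(x, y). {x, y} = e} \<subseteq> {(a, b), (b, a)}" by (auto simp: e doubleton_eq_iff)
    then have "card {(x, y). {x, y} = e} \<le> card {(a, b), (b, a)}" by (intro card_mono) auto
    also have "\<dots> \<le> 2" by (cases "a = b") simp_all
    finally show "card {(x, y). {x, y} = e} \<le> 2" .
  qed
  finally show ?thesis by simp
qed

section \<open>Extending the distances by one layer\<close>

definition holds_input :: "state \<Rightarrow> bool" where
  "holds_input s \<longleftrightarrow> fst s 0 = n \<and> (\<forall>v\<le>n. snd s 0 v = off v) \<and> (\<forall>i<M. snd s 1 i = ends i)"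

definition frame :: "nat \<Rightarrow> state \<Rightarrow> state \<Rightarrow> bool" where
  "frame D s s' \<longleftrightarrow> fst s' 0 = fst s 0 \<and> (\<forall>A. A \<noteq> D \<longrightarrow> snd s' A = snd s A)"

lemma frame_trans: "frame D s s' \<Longrightarrow> frame D s' s'' \<Longrightarrow> frame D s s''"
  by (simp add: frame_def)

lemma holds_input_frame: "holds_input s \<Longrightarrow> frame D s s' \<Longrightarrow> 2 \<le> D \<Longrightarrow> holds_input s'"
  by (auto simp: holds_input_def frame_def)

text \<open>The contents of the distance array once exactly the vertices at distance less than
  \<open>k\<close> are marked.\<close>

definition level :: "nat \<Rightarrow> nat \<Rightarrow> nat \<Rightarrow> nat" where
  "level w k x = (if d w x < k then Suc (d w x) else 0)"

text \<open>The vertices of layer \<open>Suc k\<close> reached so far when the scan stands at vertex \<open>v\<close> and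
  index \<open>i\<close>.\<close>

definition reached :: "nat \<Rightarrow> nat \<Rightarrow> nat \<Rightarrow> nat \<Rightarrow> nat \<Rightarrow> bool" where
  "reached w k v i x \<longleftrightarrow> (\<exists>y<v. y \<sim> x \<and> d w y = k) \<or>
     (v < n \<and> d w v = k \<and> x \<in> ends ` {off v..<i})"

definition scan_inv :: "state \<Rightarrow> nat \<Rightarrow> nat \<Rightarrow> nat \<Rightarrow> state \<Rightarrow> bool" where
  "scan_inv s0 D w k s \<longleftrightarrow> frame D s0 s \<and> fst s 2 \<le> n \<and> off (fst s 2) \<le> fst s 3 \<and>
     (fst s 2 < n \<longrightarrow> fst s 3 \<le> off (Suc (fst s 2))) \<and>
     (\<forall>x<n. snd s D x = (if d w x < Suc k then Suc (d w x)
        else if d w x = Suc k \<and> reached w k (fst s 2) (fst s 3) x then Suc (Suc k) else 0))"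

lemma reached_step:
  assumes "off v \<le> i"
  shows "reached w k v (Suc i) x \<longleftrightarrow> reached w k v i x \<or> (v < n \<and> d w v = k \<and> x = ends i)"
  using assms by (auto simp: reached_def atLeastLessThanSuc)

text \<open>At this index the segment of \<open>v\<close> is its whole neighbourhood, and that of
  the next vertex is still empty.\<close>

lemma reached_next:
  assumes "v < n" "i = off (Suc v)"
  shows "reached w k (Suc v) i x \<longleftrightarrow> reached w k v i x"
  using assms ends_image[OF assms(1)] by (auto simp: reached_def neighbours_def less_Suc_eq)

lemma reached_end:
  assumes "w < n" "x < n" "d w x = Suc k"
  shows "reached w k n i x"
proof -
  obtain y where "y \<sim> x" "d w y = k" using gdist_pred[of w x] assms by (auto simp: V_eq)
  moreover have "y < n" using adjacentD(1)[OF \<open>y \<sim> x\<close>] by (simp add: V_eq)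
  ultimately show ?thesis by (auto simp: reached_def)
qed

text \<open>The measure falls because each iteration advances either the index or the
  vertex.\<close>

lemma scan_step:
  assumes input: "holds_input s0" and D: "2 \<le> D" and w: "w < n"
    and W: "n \<le> W" "M \<le> W" "Suc (Suc k) \<le> W"
    and inv: "scan_inv s0 D w k s" and v: "fst s 2 < n"
  shows "pfits W (scan_body D (Suc k)) s \<and> scan_inv s0 D w k (prun (scan_body D (Suc k)) s) \<and>
    n - fst (prun (scan_body D (Suc k)) s) 2 + (M - fst (prun (scan_body D (Suc k)) s) 3)
      < n - fst s 2 + (M - fst s 3)"
proof -
  let ?v = "fst s 2" and ?i = "fst s 3"
  have fr: "frame D s0 s" and i: "off ?v \<le> ?i" "?i \<le> off (Suc ?v)"
    using inv v by (auto simp: scan_inv_def)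
  have arr: "snd s D x = (if d w x < Suc k then Suc (d w x)
        else if d w x = Suc k \<and> reached w k ?v ?i x then Suc (Suc k) else 0)" if "x < n" for x
    using inv v that by (auto simp: scan_inv_def)
  have inp: "fst s 0 = n" "\<And>v. v \<le> n \<Longrightarrow> snd s 0 v = off v" "\<And>i. i < M \<Longrightarrow> snd s 1 i = ends i"
    using holds_input_frame[OF input fr D] by (auto simp: holds_input_def)
  have arr_le: "snd s D x \<le> W" if "x < n" for x using arr[OF that] W(3) by auto
  have offW: "off (Suc ?v) \<le> W" "off (Suc ?v) \<le> M" using off_le_M[of "Suc ?v"] v W(2) by auto
  have bv: "snd s 0 (Suc ?v) = off (Suc ?v)" using inp(2)[of "Suc ?v"] v by simp
  show ?thesis
  proof (cases "?i < off (Suc ?v)")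
    case True
    define u where "u = ends ?i"
    have iM: "?i < M" using True offW by simp
    have r: "snd s 1 ?i = u" using inp(3)[OF iM] by (simp add: u_def)
    have "u \<in> neighbours G ?v" using ends_image[OF v] True i by (auto simp: u_def)
    then have vu: "?v \<sim> u" by (simp add: neighbours_def)
    have u: "u < n" using adjacentD(2)[OF vu] by (simp add: V_eq)
    \<comment> \<open>If \<open>?v\<close> is in layer \<open>k\<close>, a neighbour still at 0
      therefore has distance exactly \<open>Suc k\<close>, so its mark is right.\<close>
    have du: "d w u \<le> Suc (d w ?v)" using gdist_step[OF _ vu] w by (simp add: V_eq)
    \<comment> \<open>Marks set during this scan are \<open>Suc (Suc k)\<close>, so they are not
      expanded in the same scan.\<close>
    have dv: "snd s D ?v = Suc k \<longleftrightarrow> d w ?v = k" using arr[OF v] by auto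
    have reach: "reached w k ?v (Suc ?i) x \<longleftrightarrow> reached w k ?v ?i x \<or> (d w ?v = k \<and> x = u)" for x
      using reached_step[OF i(1)] v by (simp add: u_def)
    have fits: "pfits W (scan_body D (Suc k)) s"
      using v W bv offW i iM arr_le[OF v] arr_le[OF u] u True
      by (auto simp: scan_body_def r r[simplified])
    define s' where "s' = prun (scan_body D (Suc k)) s"
    have s': "s' = ((fst s)(3 := Suc ?i), if d w ?v = k \<and> snd s D u = 0
        then (snd s)(D := (snd s D)(u := Suc (Suc k))) else snd s)"
      using True by (simp add: s'_def scan_body_def r r[simplified] bv dv)
    have "scan_inv s0 D w k s'"
    proof -
      have "snd s' D x = (if d w x < Suc k then Suc (d w x)
        else if d w x = Suc k \<and> reached w k ?v (Suc ?i) x then Suc (Suc k) else 0)" if "x < n" for x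
        using arr[OF that] arr[OF u] du by (auto simp: s' reach)
      moreover have "frame D s0 s'" using fr by (auto simp: frame_def s')
      ultimately show ?thesis using True i v by (simp add: scan_inv_def s')
    qed
    moreover have "n - fst s' 2 + (M - fst s' 3) < n - ?v + (M - ?i)" using iM by (simp add: s')
    ultimately show ?thesis using fits s'_def by simp
  next
    case False
    then have ie: "?i = off (Suc ?v)" using i by simp
    have fits: "pfits W (scan_body D (Suc k)) s"
      using v W bv offW i False by (auto simp: scan_body_def)
    define s' where "s' = prun (scan_body D (Suc k)) s"
    have s': "s' = ((fst s)(2 := Suc ?v), snd s)"
      using False by (simp add: s'_def scan_body_def bv)
    have "scan_inv s0 D w k s'"
      using fr arr v ie off_mono[of "Suc ?v" "Suc (Suc ?v)"] reached_next[OF v ie]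
      by (simp add: scan_inv_def s' frame_def)
    moreover have "n - fst s' 2 + (M - fst s' 3) < n - ?v + (M - ?i)" using v by (simp add: s')
    ultimately show ?thesis using fits s'_def by simp
  qed
qed

lemma runs_scan:
  assumes input: "holds_input s" and D: "2 \<le> D" and w: "w < n"
    and W: "n \<le> W" "M \<le> W" "Suc (Suc k) \<le> W"
    and arr: "\<forall>x<n. snd s D x = level w (Suc k) x"
  shows "runs W (scan D (Suc k)) s ((n + M + 1) * 50)
    (\<lambda>s'. holds_input s' \<and> frame D s s' \<and> (\<forall>x<n. snd s' D x = level w (Suc (Suc k)) x))"
proof -
  let ?init = "Seq (Assign 2 (Const 0)) (Assign 3 (Const 0))"
  let ?b = "Less (Reg 2) (Reg 0)" and ?I = "scan_inv s D w k"
  have init: "runs W ?init s 4 (\<lambda>s'. s' = prun ?init s)"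
    by (rule runs_mono[OF runs_loop_free]) simp_all
  have I0: "?I (prun ?init s)"
    using arr by (simp add: scan_inv_def frame_def off_0 reached_def level_def)
  have "runs W (WHILE ?b (scan_body D (Suc k))) (prun ?init s)
    (Suc (n - fst (prun ?init s) 2 + (M - fst (prun ?init s) 3)) * (bcost ?b + 1 + pcost (scan_body D (Suc k))))
    (\<lambda>s'. ?I s' \<and> \<not> bval s' ?b)"
  proof (rule runs_WHILE[where \<mu> = "\<lambda>s. n - fst s 2 + (M - fst s 3)" and I = ?I, OF I0])
    fix s' assume I: "?I s'"
    then have n: "fst s' 0 = n" using input by (auto simp: scan_inv_def frame_def holds_input_def)
    show "bfits W s' ?b" using I n W by (simp add: scan_inv_def)
    assume "bval s' ?b"
    then show "pfits W (scan_body D (Suc k)) s' \<and> ?I (prun (scan_body D (Suc k)) s') \<and>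
      n - fst (prun (scan_body D (Suc k)) s') 2 + (M - fst (prun (scan_body D (Suc k)) s') 3)
        < n - fst s' 2 + (M - fst s' 3)"
      using scan_step[OF input D w W I] n by simp
  qed
  then have "runs W (scan D (Suc k)) s (4 + Suc (n + M) * (bcost ?b + 1 + pcost (scan_body D (Suc k))))
    (\<lambda>s'. ?I s' \<and> \<not> bval s' ?b)"
    unfolding scan_def by (intro runs_Seq[OF init]) simp
  then show ?thesis
  proof (rule runs_mono)
    \<comment> \<open>An iteration costs at most 35 steps here and 42 in \<open>select\<close>; 50
      covers both, with the initialisation.\<close>
    show "4 + Suc (n + M) * (bcost ?b + 1 + pcost (scan_body D (Suc k))) \<le> (n + M + 1) * 50"
      by (simp add: scan_body_def)
    fix s' assume s': "?I s' \<and> \<not> bval s' ?b"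
    then have fr: "frame D s s'" by (simp add: scan_inv_def)
    have inp: "holds_input s'" using holds_input_frame[OF input fr D] .
    then have v: "fst s' 2 = n" using s' by (simp add: scan_inv_def holds_input_def)
    have "snd s' D x = level w (Suc (Suc k)) x" if "x < n" for x
      using s' that reached_end[OF w that] by (auto simp: scan_inv_def v level_def)
    then show "holds_input s' \<and> frame D s s' \<and> (\<forall>x<n. snd s' D x = level w (Suc (Suc k)) x)"
      using fr inp by simp
  qed
qed

section \<open>Selecting the farthest vertex\<close>

definition deg where "deg v = off (Suc v) - off v"

text \<open>The lexicographic optimum, greater \<open>f\<close> first and then smaller degree. For
  \<open>m = 0\<close> any vertex qualifies, so the search may start with 0.\<close>

definition best :: "(nat \<Rightarrow> nat) \<Rightarrow> nat \<Rightarrow> nat \<Rightarrow> bool" where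
  "best f m z \<longleftrightarrow> z < n \<and> (\<forall>x<m. f x \<le> f z \<and> (f x = f z \<longrightarrow> deg z \<le> deg x))"

definition select_inv :: "state \<Rightarrow> nat \<Rightarrow> state \<Rightarrow> bool" where
  "select_inv s0 D s \<longleftrightarrow> fst s 0 = n \<and> snd s = snd s0 \<and> fst s 2 \<le> n \<and>
     best (snd s0 D) (fst s 2) (fst s 4)"

lemma best_step:
  assumes "best f m z" "m < n"
  shows "best f (Suc m) (if \<not> f z < f m \<and> \<not> (f z = f m \<and> deg m < deg z) then z else m)"
  using assms by (fastforce simp: best_def less_Suc_eq)

lemma select_step:
  assumes input: "holds_input s0" and W: "n \<le> W" "M \<le> W" "\<forall>x<n. snd s0 D x \<le> W"
    and inv: "select_inv s0 D s" and v: "fst s 2 < n"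
  shows "pfits W (select_body D) s \<and> select_inv s0 D (prun (select_body D) s) \<and>
    n - fst (prun (select_body D) s) 2 < n - fst s 2"
proof -
  let ?v = "fst s 2" and ?z = "fst s 4"
  have s: "fst s 0 = n" "snd s = snd s0" and best: "best (snd s0 D) ?v ?z" and z: "?z < n"
    using inv by (auto simp: select_inv_def best_def)
  have off: "snd s0 0 x = off x" "snd s0 0 (Suc x) = off (Suc x)" "off x \<le> W" "off (Suc x) \<le> W"
    if "x < n" for x
    using input that off_le_M[of x] off_le_M[of "Suc x"] W(2) by (auto simp: holds_input_def)
  have fits: "pfits W (select_body D) s"
    using v z W off[OF v] off[OF z] by (auto simp: select_body_def degree_exp_def s)
  have "prun (select_body D) s = ((fst s)
      (4 := if \<not> snd s0 D ?z < snd s0 D ?v \<and> \<not> (snd s0 D ?z = snd s0 D ?v \<and> deg ?v < deg ?z)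
        then ?z else ?v, 2 := Suc ?v), snd s0)"
    using off[OF v] off[OF z] by (auto simp: select_body_def degree_exp_def s deg_def)
  then show ?thesis using fits best_step[OF best v] v by (simp add: select_inv_def s)
qed

lemma runs_select:
  assumes input: "holds_input s" and W: "n \<le> W" "M \<le> W" "\<forall>x<n. snd s D x \<le> W"
  shows "runs W (select D) s ((n + M + 1) * 50)
    (\<lambda>s'. holds_input s' \<and> snd s' = snd s \<and> best (snd s D) n (fst s' 4))"
proof -
  let ?init = "Seq (Assign 2 (Const 0)) (Assign 4 (Const 0))"
  let ?b = "Less (Reg 2) (Reg 0)" and ?I = "select_inv s D"
  have init: "runs W ?init s 4 (\<lambda>s'. s' = prun ?init s)"
    by (rule runs_mono[OF runs_loop_free]) simp_all
  have I0: "?I (prun ?init s)"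
    using input n_pos by (simp add: select_inv_def best_def holds_input_def)
  have "runs W (WHILE ?b (select_body D)) (prun ?init s)
    (Suc (n - fst (prun ?init s) 2) * (bcost ?b + 1 + pcost (select_body D)))
    (\<lambda>s'. ?I s' \<and> \<not> bval s' ?b)"
  proof (rule runs_WHILE[where \<mu> = "\<lambda>s. n - fst s 2" and I = ?I, OF I0])
    fix s' assume I: "?I s'"
    show "bfits W s' ?b" using I W by (simp add: select_inv_def)
    assume "bval s' ?b"
    then show "pfits W (select_body D) s' \<and> ?I (prun (select_body D) s') \<and>
      n - fst (prun (select_body D) s') 2 < n - fst s' 2"
      using select_step[OF input W I] I by (simp add: select_inv_def)
  qed
  then have "runs W (select D) s (4 + Suc n * (bcost ?b + 1 + pcost (select_body D)))
    (\<lambda>s'. ?I s' \<and> \<not> bval s' ?b)"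
    unfolding select_def by (intro runs_Seq[OF init]) simp
  then show ?thesis
    by (rule runs_mono)
       (use input in \<open>auto simp: select_body_def degree_exp_def select_inv_def holds_input_def\<close>)
qed

section \<open>One sweep and the whole program\<close>

lemma runs_sweep:
  assumes input: "holds_input s" and D: "2 \<le> D" and w: "fst s 4 < n"
    and W: "n \<le> W" "M \<le> W" "6 \<le> W" and zero: "snd s D = (\<lambda>_. 0)"
  shows "runs W (sweep D) s ((n + M + 1) * 303)
    (\<lambda>s'. holds_input s' \<and> frame D s s' \<and> farthest (fst s 4) (fst s' 4) \<and>
       snd s' D (fst s' 4) = Suc (d (fst s 4) (fst s' 4)))"
proof -
  let ?w = "fst s 4"
  let ?N = "(n + M + 1) * 50"
  let ?Q = "\<lambda>k s'. holds_input s' \<and> frame D s s' \<and> (\<forall>x<n. snd s' D x = level ?w (Suc k) x)"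
  have wV: "?w \<in> V" using w by (simp add: V_eq)
  have d5: "d ?w x \<le> 5" if "x < n" for x using gdist_le_5[OF wV] that by (simp add: V_eq)
  have init: "runs W (Write D (Reg 4) (Const 1)) s 3 (?Q 0)"
  proof (rule runs_mono[OF runs_loop_free])
    fix s' assume s': "s' = prun (Write D (Reg 4) (Const 1)) s"
    then have fr: "frame D s s'" by (simp add: frame_def)
    have "snd s' D x = level ?w (Suc 0) x" if "x < n" for x
      using gdist_eq_0[OF wV, of x] gdist_same[of x] that zero by (simp add: s' level_def V_eq)
    then show "?Q 0 s'" using fr holds_input_frame[OF input fr D] by simp
  qed (use w W in auto)
  have step: "runs W (scan D k') s1 ?N (?Q k')" if "k' = Suc k" "?Q k s1" "k < 5" for k k' s1
    unfolding that(1)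
    by (rule runs_mono[OF runs_scan[OF _ D w W(1,2)]]) (use that W in \<open>auto intro: frame_trans\<close>)
  have sel: "runs W (select D) s1 ?N
    (\<lambda>s'. holds_input s' \<and> frame D s s' \<and> farthest ?w (fst s' 4) \<and>
       snd s' D (fst s' 4) = Suc (d ?w (fst s' 4)))" if Q: "?Q 5 s1" for s1
  proof -
    \<comment> \<open>After five scans all distances up to 5 are marked, so no vertex is left at
      0.\<close>
    have arr: "snd s1 D x = Suc (d ?w x)" if "x < n" for x
      using Q d5[OF that] that by (simp add: level_def)
    have "\<forall>x<n. snd s1 D x \<le> W" using arr d5 W(3) by fastforce
    then show ?thesis
    proof (rule runs_mono[OF runs_select[OF conjunct1[OF Q] W(1,2)]])
      fix s' assume s': "holds_input s' \<and> snd s' = snd s1 \<and> best (snd s1 D) n (fst s' 4)"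
      let ?z = "fst s' 4"
      have z: "?z < n" using s' by (simp add: best_def)
      have "frame D s s'" using Q s' by (auto simp: frame_def holds_input_def)
      \<comment> \<open>The stored values exceed the distances by one throughout, which leaves
        comparisons unchanged.\<close>
      moreover have "farthest ?w ?z"
        using s' z by (auto simp: farthest_def best_def arr V_eq card_neighbours deg_def)
      ultimately show "holds_input s' \<and> frame D s s' \<and> farthest ?w ?z \<and> snd s' D ?z = Suc (d ?w ?z)"
        using s' arr[OF z] by simp
    qed simp
  qed
  \<comment> \<open>The 3 is the initial write; five scans and one selection cost \<open>?N\<close>
    each.\<close>
  have "runs W (sweep D) s (3 + (?N + (?N + (?N + (?N + (?N + ?N))))))
    (\<lambda>s'. holds_input s' \<and> frame D s s' \<and> farthest ?w (fst s' 4) \<and>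
       snd s' D (fst s' 4) = Suc (d ?w (fst s' 4)))"
    unfolding sweep_def
    by (rule runs_Seq[OF init], rule runs_Seq[OF step[of 1 0]], simp, assumption, simp,
        rule runs_Seq[OF step[of 2 1]], simp, assumption, simp,
        rule runs_Seq[OF step[of 3 2]], simp, assumption, simp,
        rule runs_Seq[OF step[of 4 3]], simp, assumption, simp,
        rule runs_Seq[OF step[of 5 4]], simp, assumption, simp, rule sel)
  then show ?thesis by (rule runs_mono) auto
qed

lemma runs_diam_prog:
  assumes W: "n \<le> W" "M \<le> W" "6 \<le> W"
  shows "runs W diam_prog (input_state G adj) ((n + M + 1) * 950)
    (\<lambda>s. result s = (if diam G = 5 then 1 else 0))"
proof -
  let ?s = "input_state G adj"
  let ?N = "(n + M + 1) * 303"
  have reg4: "fst ?s 4 = 0" by (simp add: input_state_def)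
  have zero: "snd ?s D = (\<lambda>_. 0)" if "2 \<le> D" for D using that by (simp add: input_state_def)
  have input: "holds_input ?s"
    by (simp add: holds_input_def input_state_def V_eq off_def ends_def n_def M_def)
  \<comment> \<open>The postconditions keep the arrays of the coming sweeps at zero; the bound 6 in
    \<open>?Q3\<close> lets the final read fit into a word.\<close>
  let ?Q1 = "\<lambda>s. holds_input s \<and> farthest 0 (fst s 4) \<and> (\<forall>D>2. snd s D = (\<lambda>_. 0))"
  let ?Q2 = "\<lambda>s. holds_input s \<and> (\<exists>z. farthest 0 z \<and> farthest z (fst s 4)) \<and> (\<forall>D>3. snd s D = (\<lambda>_. 0))"
  let ?Q3 = "\<lambda>s. holds_input s \<and> fst s 4 < n \<and> (snd s 4 (fst s 4) = 6 \<longleftrightarrow> diam G = 5) \<and> snd s 4 (fst s 4) \<le> 6"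
  have 1: "runs W (sweep 2) ?s ?N ?Q1"
    by (rule runs_mono[OF runs_sweep[OF input _ _ W zero]])
       (use n_pos zero in \<open>auto simp: reg4 frame_def\<close>)
  have 2: "runs W (sweep 3) s ?N ?Q2" if "?Q1 s" for s
    by (rule runs_mono[OF runs_sweep[OF conjunct1[OF that] _ _ W]])
       (use that in \<open>auto simp: frame_def farthest_def V_eq\<close>)
  have 3: "runs W (sweep 4) s ?N ?Q3" if Q: "?Q2 s" for s
  proof (rule runs_mono[OF runs_sweep[OF conjunct1[OF that] _ _ W]])
    obtain z where z: "farthest 0 z" "farthest z (fst s 4)" using Q by blast
    have y: "fst s 4 \<in> V" using z(2) by (simp add: farthest_def)
    then show "fst s 4 < n" by (simp add: V_eq)
    fix s' assume s': "holds_input s' \<and> frame 4 s s' \<and> farthest (fst s 4) (fst s' 4) \<and>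
       snd s' 4 (fst s' 4) = Suc (d (fst s 4) (fst s' 4))"
    have x: "fst s' 4 \<in> V" using s' by (simp add: farthest_def)
    have "diam G = 5 \<longleftrightarrow> d (fst s 4) (fst s' 4) = 5"
      by (rule diam_5_iff_farthest[OF _ z]) (use s' n_pos in \<open>auto simp: V_eq\<close>)
    then show "?Q3 s'" using s' x gdist_le_5[OF y x] by (simp add: V_eq)
  qed (use Q in auto)
  have 4: "runs W (IF (Equal (Read 4 (Reg 4)) (Const 6)) (Assign 0 (Const 1)) (Assign 0 (Const 0))) s 9
    (\<lambda>s. result s = (if diam G = 5 then 1 else 0))" if "?Q3 s" for s
    by (rule runs_mono[OF runs_loop_free]) (use that W in \<open>auto simp: result_def\<close>)
  have "runs W diam_prog ?s (?N + (?N + (?N + 9))) (\<lambda>s. result s = (if diam G = 5 then 1 else 0))"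
    unfolding diam_prog_def by (intro runs_Seq[OF 1] runs_Seq[OF 2] runs_Seq[OF 3] 4)
  then show ?thesis by (rule runs_mono) auto
qed

end


section \<open>Word size and the linear time bound\<close>

theorem theorem17:
  "d_max graph_2P2_P1 = 5 \<and>
   (\<exists>p c k. \<forall>(G :: nat graph) adj n m.
      simple_graph G \<longrightarrow> connected_graph G \<longrightarrow> free_of graph_2P2_P1 G \<longrightarrow>
      n = card (verts G) \<longrightarrow> m = card (edges G) \<longrightarrow> adj_lists G adj \<longrightarrow>
      (\<exists>t s. exec ((n + m + 1) ^ k) p (input_state G adj) t s \<and>
             t \<le> c * (n + m) \<and>
             result s = (if diam G = 5 then 1 else 0)))"
proof -
  have "\<exists>t s. exec ((n + m + 1) ^ 3) diam_prog (input_state G adj) t s \<and> t \<le> 2850 * (n + m) \<and>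
      result s = (if diam G = 5 then 1 else 0)"
    if "simple_graph G" "connected_graph G" "free_of graph_2P2_P1 G"
      "n = card (verts G)" "m = card (edges G)" "adj_lists G adj"
    for G :: "nat graph" and adj n m
  proof -
    interpret input: graph_input G adj using that by unfold_locales
    have nn: "input.n = n" using input.V_eq that(4) by simp
    have n: "0 < n" using input.n_pos nn by simp
    have M: "input.M \<le> 2 * m" using input.M_le that(5) by simp
    \<comment> \<open>The exponent 3 serves the one-vertex graph, where \<open>n + m + 1 = 2\<close>
      and the words must still hold 6.\<close>
    have "2 ^ 2 \<le> (n + m + 1) ^ 2" using n by (intro power_mono) auto
    then have "4 * (n + m + 1) \<le> (n + m + 1) ^ 2 * (n + m + 1)" by (intro mult_le_mono1) simp
    also have "\<dots> = (n + m + 1) ^ 3" by (simp add: power3_eq_cube power2_eq_square)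
    finally have "4 * (n + m + 1) \<le> (n + m + 1) ^ 3" .
    moreover have "n \<le> 4 * (n + m + 1)" "input.M \<le> 4 * (n + m + 1)" "6 \<le> 4 * (n + m + 1)"
      using n M by simp_all
    ultimately have W: "n \<le> (n + m + 1) ^ 3" "input.M \<le> (n + m + 1) ^ 3" "6 \<le> (n + m + 1) ^ 3"
      by (blast intro: le_trans)+
    have "runs ((n + m + 1) ^ 3) diam_prog (input_state G adj) ((n + input.M + 1) * 950)
      (\<lambda>s. result s = (if diam G = 5 then 1 else 0))"
      by (rule input.runs_diam_prog[unfolded nn, OF W])
    \<comment> \<open>As \<open>n\<close> is positive, \<open>n + 2 * m + 1\<close> is at most
      \<open>3 * (n + m)\<close>, and 2850 is three times 950.\<close>
    moreover have "(n + input.M + 1) * 950 \<le> 2850 * (n + m)" using n M by simp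
    ultimately show ?thesis unfolding runs_def by (meson le_trans)
  qed
  then show ?thesis using d_max_2P2_P1 by blast
qed

end
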